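(* Let $a,b,c$ be complex numbers. The generating function $$g(x)=\frac{1}{1-ax-bx^2}\,C\left(\frac{-x^2(b+cx)}{(1-ax-bx^2)^2}\right)$$ is involutory, where $C(x)=\frac{1-\sqrt{1-4x}}{2x}=\sum_{n\ge 0}\frac{1}{n+1}\binom{2n}{n}x^n$ is the generating function of the Catalan numbers.
   Context: All power series are formal, with complex coefficients. The symbol $c$ is a scalar parameter; $C(\cdot)$ is the Catalan generating function. Riordan arrays: for $g(x)=1+g_1x+\cdots$ and $f(x)=f_1x+f_2x^2+\cdots$ with $f_1\neq 0$, the Riordan array $(g(x),f(x))$ is the infinite lower triangular matrix with entries $t_{n,k}=[x^n]\,g(x)f(x)^k$, $n,k\ge 0$. The product of Riordan arrays is $(g,f)\cdot(u,v)=(g(x)u(f(x)),v(f(x)))$, and the identity is $(1,x)$. A power series $g(x)$ with $g(0)=1$ is called involutory if $(g(x),-xg(x))^2=(1,x)$, i.e. if the Bell array $(g(x),xg(x))$ is a pseudo-involution. *)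

theory Defs
  imports Complex_Main "HOL-Computational_Algebra.Formal_Power_Series"
begin

definition is_riordan_pair :: "complex fps \<times> complex fps \<Rightarrow> bool" where
  "is_riordan_pair = (\<lambda>(g, f).
     fps_nth g 0 = 1 \<and> fps_nth f 0 = 0 \<and> fps_nth f 1 \<noteq> 0)"

definition riordan_array :: "complex fps \<times> complex fps \<Rightarrow> nat \<Rightarrow> nat \<Rightarrow> complex" where
  "riordan_array = (\<lambda>(g, f) n k. fps_nth (g * f ^ k) n)"

definition riordan_mult ::
  "complex fps \<times> complex fps \<Rightarrow> complex fps \<times> complex fps \<Rightarrow> complex fps \<times> complex fps" where
  "riordan_mult = (\<lambda>(g, f) (u, v). (g * fps_compose u f, fps_compose v f))"

definition involutory :: "complex fps \<Rightarrow> bool" where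
  "involutory g \<longleftrightarrow>
     fps_nth g 0 = 1 \<and>
     riordan_array (riordan_mult (g, - fps_X * g) (g, - fps_X * g)) = riordan_array (1, fps_X)"

definition catalan_fps :: "complex fps" where
  "catalan_fps = Abs_fps (\<lambda>n. of_nat ((2 * n) choose n) / of_nat (n + 1))"

lemma is_riordan_pair_mult:
  assumes "is_riordan_pair p" "is_riordan_pair q"
  shows "is_riordan_pair (riordan_mult p q)"
  using assms
  by (auto simp: is_riordan_pair_def riordan_mult_def fps_compose_nth split: prod.splits)

text \<open>
  The product of pairs is the product of the lower triangular matrices, so every sum is finite.
\<close>

lemma riordan_array_mult:
  assumes "is_riordan_pair p" "is_riordan_pair q"
  shows "riordan_array (riordan_mult p q) n k =
           (\<Sum>j\<le>n. riordan_array p n j * riordan_array q j k)"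
proof -
  obtain g f u v where pq: "p = (g, f)" "q = (u, v)" by (cases p, cases q)
  from assms pq have f0: "fps_nth f 0 = 0" by (simp add: is_riordan_pair_def)
  have zero: "fps_nth (f ^ j) i = 0" if "i < j" for i j
    using that f0 by (simp add: startsby_zero_power_prefix)
  define w where "w = u * v ^ k"
  have w: "fps_compose u f * fps_compose v f ^ k = fps_compose w f"
    using f0 by (simp add: w_def fps_compose_mult_distrib fps_compose_power)
  have "fps_nth (fps_compose w f) i = (\<Sum>j\<le>n. fps_nth w j * fps_nth (f ^ j) i)"
    if "i \<le> n" for i
    unfolding fps_compose_nth using that zero by (intro sum.mono_neutral_left) auto
  then have "fps_nth (g * fps_compose w f) n =
      (\<Sum>i=0..n. fps_nth g i * (\<Sum>j\<le>n. fps_nth w j * fps_nth (f ^ j) (n - i)))"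
    by (simp add: fps_mult_nth)
  also have "\<dots> = (\<Sum>j\<le>n. fps_nth (g * f ^ j) n * fps_nth w j)"
    by (simp add: fps_mult_nth sum_distrib_left sum_distrib_right ac_simps
        sum.swap[of _ "{0..n}" "{..n}"])
  finally show ?thesis
    by (simp add: pq riordan_mult_def riordan_array_def w_def[symmetric] w mult.assoc)
qed

lemma riordan_array_eq_iff:
  assumes "is_riordan_pair p" "is_riordan_pair q"
  shows "riordan_array p = riordan_array q \<longleftrightarrow> p = q"
proof
  assume eq: "riordan_array p = riordan_array q"
  obtain g f u v where pq: "p = (g, f)" "q = (u, v)" by (cases p, cases q)
  have col: "g * f ^ k = u * v ^ k" for k
    using fun_cong[OF fun_cong[OF eq]] by (auto simp: fps_eq_iff pq riordan_array_def)
  have "g \<noteq> 0" using assms pq by (auto simp: is_riordan_pair_def)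
  then show "p = q" using col[of 0] col[of 1] pq by simp
qed simp

lemma riordan_array_one: "riordan_array (1, fps_X) n k = (if n = k then 1 else 0)"
  by (simp add: riordan_array_def)

text \<open>
  The series \<open>1 - 2xC(x)\<close>, whose constant term is 1, is the square root of \<open>1 - 4x\<close>, which is
  the closed form of the Catalan generating function.
\<close>

lemma catalan_fps_closed_form: "(1 - 2 * fps_X * catalan_fps)\<^sup>2 = 1 - 4 * fps_X"
proof -
  have rec: "fps_nth catalan_fps (Suc n) =
      2 * (2 * of_nat n + 1) / (of_nat n + 2) * fps_nth catalan_fps n" for n
  proof -
    have cb: "(of_nat ((2 * m) choose m) :: complex) = fact (2 * m) / (fact m * fact m)" for m
      by (subst binomial_fact) (simp_all add: mult_2)
    have nz: "(of_nat n :: complex) + 1 \<noteq> 0" "(of_nat n :: complex) + 2 \<noteq> 0"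
      using of_nat_neq_0[of n, where 'a = complex] of_nat_neq_0[of "Suc n", where 'a = complex]
      by (simp_all add: add.commute)
    have f: "(fact (2 * Suc n) :: complex) =
        2 * (of_nat n + 1) * (2 * of_nat n + 1) * fact (2 * n)"
      by (simp add: algebra_simps)
    have "fps_nth catalan_fps (Suc n) = fact (2 * Suc n) /
        ((of_nat n + 1) * fact n * ((of_nat n + 1) * fact n)) / (of_nat n + 2)"
      unfolding catalan_fps_def fps_nth_Abs_fps cb by (simp add: add.commute)
    also have "\<dots> = 2 * (2 * of_nat n + 1) / (of_nat n + 2) *
        (fact (2 * n) / (fact n * fact n) / (of_nat n + 1))"
      unfolding f using nz by (simp add: divide_simps) (simp add: algebra_simps)
    also have "fact (2 * n) / (fact n * fact n) / (of_nat n + 1) = fps_nth catalan_fps n"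
      unfolding catalan_fps_def fps_nth_Abs_fps cb by simp
    finally show ?thesis .
  qed
  have half: "- 2 * fps_nth catalan_fps n = ((1/2) gchoose Suc n) * (- 4) ^ Suc n" for n
  proof (induction n)
    case 0
    show ?case by (simp add: catalan_fps_def)
  next
    case (Suc n)
    have nz: "(of_nat n :: complex) + 2 \<noteq> 0"
      using of_nat_neq_0[of "Suc n", where 'a = complex] by (simp add: add.commute)
    have "(of_nat n + 2) * (r gchoose Suc (Suc n)) =
        (r - (of_nat n + 1)) * (r gchoose Suc n)" for r :: complex
      using gbinomial_mult_1[of r "Suc n"] by (simp add: algebra_simps)
    note step = this[of "1/2"]
    have "(of_nat n + 2) * (- 2 * fps_nth catalan_fps (Suc n)) =
        2 * (2 * of_nat n + 1) * (- 2 * fps_nth catalan_fps n)"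
      using nz by (simp add: rec)
    also have "\<dots> = ((1/2 - (of_nat n + 1)) * (1/2 gchoose Suc n)) * (- 4) ^ Suc (Suc n)"
      unfolding Suc.IH by (simp add: algebra_simps)
    also have "\<dots> = (of_nat n + 2) * ((1/2 gchoose Suc (Suc n)) * (- 4) ^ Suc (Suc n))"
      unfolding step[symmetric] by (simp only: mult.assoc)
    finally show ?case using nz mult_left_cancel by blast
  qed
  define S where "S = 1 - 2 * fps_X * catalan_fps"
  have "S = fps_compose (fps_binomial (1/2)) (fps_const (- 4) * fps_X)"
  proof (rule fps_ext)
    fix n
    show "fps_nth S n = fps_nth (fps_compose (fps_binomial (1/2)) (fps_const (- 4) * fps_X)) n"
      using half by (cases n) (simp_all add: S_def fps_compose_linear mult.assoc numeral_fps_const)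
  qed
  then have "S\<^sup>2 = fps_compose ((fps_binomial (1/2))\<^sup>2) (fps_const (- 4) * fps_X)"
    by (simp add: fps_compose_power)
  also have "(fps_binomial (1/2) :: complex fps)\<^sup>2 = 1 + fps_X"
    by (simp add: power2_eq_square fps_binomial_add_mult[symmetric] fps_binomial_1)
  finally show ?thesis by (simp add: S_def fps_compose_add_distrib numeral_fps_const fps_const_neg[symmetric] del: fps_const_neg)
qed

end

theory Submission
  imports Defs
begin

text \<open>
  The Catalan equation turns the formula for \<open>g\<close> into the quadratic equation
  \<open>(1 - ax - bx\<^sup>2) g = 1 - x\<^sup>2 (b + cx) g\<^sup>2\<close>, which has only one power series solution.
  Substituting \<open>y = -x g(x)\<close> for \<open>x\<close>, this equation becomes one that \<open>g(y)\<close> satisfies and that is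
  also satisfied by \<open>1 / g(x)\<close>. By uniqueness \<open>g(x) g(-x g(x)) = 1\<close>, which is involutority.
\<close>

text \<open>Expanding the square in \<open>catalan_fps_closed_form\<close> gives this equation
  multiplied by \<open>4 * fps_X\<close>, which cancels.\<close>

lemma catalan_fps_eq: "catalan_fps = 1 + fps_X * catalan_fps\<^sup>2"
proof -
  have "(4 * fps_X) * catalan_fps = (4 * fps_X) * (1 + fps_X * catalan_fps\<^sup>2)"
    using catalan_fps_closed_form by (simp add: power2_eq_square algebra_simps)
  moreover have "(4 * fps_X :: complex fps) \<noteq> 0"
    by simp
  ultimately show ?thesis
    using mult_left_cancel by blast
qed

text \<open>The difference of the two equations factors as
  \<open>(g - h) * (p + q * (g + h)) = 0\<close>, and the second factor has the nonzero constant
  term of \<open>p\<close>.\<close>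

lemma fps_quadratic_unique:
  fixes g h p q :: "'a :: idom fps"
  assumes "p * g = 1 - q * g\<^sup>2" "p * h = 1 - q * h\<^sup>2"
    and "fps_nth p 0 \<noteq> 0" "fps_nth q 0 = 0"
  shows "g = h"
proof -
  have "(g - h) * (p + q * (g + h)) = 0"
    using assms(1,2) by (simp add: power2_eq_square algebra_simps)
  moreover have "fps_nth (p + q * (g + h)) 0 \<noteq> 0"
    using assms(3,4) by simp
  then have "p + q * (g + h) \<noteq> 0"
    by (metis fps_zero_nth)
  ultimately show ?thesis
    by simp
qed

text \<open>Substituting \<open>t = - q / p\<^sup>2\<close> into the Catalan equation gives
  \<open>C = 1 + t * C\<^sup>2\<close>. Since \<open>C = p * g\<close>, the last term is
  \<open>- q * g\<^sup>2\<close>.\<close>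

lemma catalan_compose_quadratic:
  fixes p q :: "complex fps"
  assumes p0: "fps_nth p 0 \<noteq> 0" and q0: "fps_nth q 0 = 0"
  defines "g \<equiv> 1 / p * fps_compose catalan_fps (- q / p\<^sup>2)"
  shows "p * g = 1 - q * g\<^sup>2"
proof -
  define t where "t = - q / p\<^sup>2"
  define C where "C = fps_compose catalan_fps t"
  have p: "p * inverse p = 1"
    using p0 by (simp add: inverse_mult_eq_1')
  have t: "t = - q * (inverse p)\<^sup>2"
    using p0 by (simp add: t_def fps_divide_unit fps_inverse_power)
  have t0: "fps_nth t 0 = 0"
    using q0 by (simp add: t)
  have g: "g = inverse p * C"
    using p0 by (simp add: g_def C_def t_def fps_divide_unit)
  have "C = fps_compose (1 + fps_X * catalan_fps\<^sup>2) t"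
    unfolding C_def using catalan_fps_eq by simp
  also have "\<dots> = 1 + t * C\<^sup>2"
    using t0 by (simp add: C_def fps_compose_add_distrib fps_compose_mult_distrib fps_compose_power)
  finally have "C = 1 + t * C\<^sup>2" .
  then have "C = 1 - q * g\<^sup>2"
    by (simp add: g t power_mult_distrib mult.assoc)
  moreover have "p * g = C"
    using p by (simp add: g flip: mult.assoc)
  ultimately show ?thesis
    by simp
qed

text \<open>The second component of the squared pair is \<open>fps_X\<close> times the first, so a
  single equation settles both.\<close>

lemma involutoryI:
  assumes g0: "fps_nth g 0 = 1" and inv: "g * fps_compose g (- fps_X * g) = 1"
  shows "involutory g"
proof -
  have "fps_compose (- fps_X * g) (- fps_X * g) = fps_X * (g * fps_compose g (- fps_X * g))"
    by (simp add: fps_compose_mult_distrib fps_compose_uminus)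
  then show ?thesis
    using g0 inv by (simp add: involutory_def riordan_mult_def)
qed

theorem proposition18:
  fixes a b c :: complex
  shows "involutory
    (1 / (1 - fps_const a * fps_X - fps_const b * fps_X\<^sup>2) *
     fps_compose catalan_fps
       (- fps_X\<^sup>2 * (fps_const b + fps_const c * fps_X) /
        (1 - fps_const a * fps_X - fps_const b * fps_X\<^sup>2)\<^sup>2))"
proof -
  define p where "p = 1 - fps_const a * fps_X - fps_const b * fps_X\<^sup>2"
  define q where "q = fps_X\<^sup>2 * (fps_const b + fps_const c * fps_X)"
  define g where "g = 1 / p * fps_compose catalan_fps (- q / p\<^sup>2)"
  define y where "y = - fps_X * g"
  define h where "h = fps_compose g y"
  have p0: "fps_nth p 0 = 1" and q0: "fps_nth q 0 = 0"
    by (simp_all add: p_def q_def)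
  have y0: "fps_nth y 0 = 0"
    by (simp add: y_def)
  have g: "p * g = 1 - q * g\<^sup>2"
    unfolding g_def using p0 q0 by (intro catalan_compose_quadratic) auto
  have g0: "fps_nth g 0 = 1"
    using arg_cong[OF g, of "\<lambda>f. fps_nth f 0"] p0 q0 by simp
  define k where "k = inverse g"
  have gk: "g * k = 1"
    using g0 by (simp add: k_def inverse_mult_eq_1')
  have py: "fps_compose p y = 1 - fps_const a * y - fps_const b * y\<^sup>2"
    and qy: "fps_compose q y = y\<^sup>2 * (fps_const b + fps_const c * y)"
    using y0 by (simp_all add: p_def q_def fps_compose_sub_distrib fps_compose_add_distrib
        fps_compose_mult_distrib power2_eq_square)
  have "fps_compose (p * g) y = fps_compose (1 - q * g\<^sup>2) y"
    by (simp only: g)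
  then have "fps_compose p y * h = 1 - fps_compose q y * h\<^sup>2"
    using y0 by (simp add: h_def fps_compose_sub_distrib fps_compose_mult_distrib fps_compose_power)
  moreover have "fps_compose p y * k = 1 - fps_compose q y * k\<^sup>2"
  proof -
    \<comment> \<open>As \<open>y = - fps_X * g\<close>, the factor \<open>y\<^sup>2\<close> of
      \<open>q(y)\<close> supplies the \<open>g\<^sup>2\<close> that \<open>k\<^sup>2\<close>
      cancels.\<close>
    have "fps_compose q y * k\<^sup>2 =
        fps_X\<^sup>2 * (fps_const b - fps_const c * fps_X * g) * (g * k)\<^sup>2"
      unfolding qy unfolding y_def by (simp add: power2_eq_square algebra_simps)
    \<comment> \<open>One factor \<open>g * k\<close> is kept, and the 1 is also written as
      \<open>g * k\<close>, so that \<open>k\<close> can be factored out below.\<close>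
    also have "\<dots> = fps_X\<^sup>2 * (fps_const b - fps_const c * fps_X * g) * (g * k)"
      by (simp add: gk)
    finally have "1 - fps_compose q y * k\<^sup>2 =
        g * k - fps_X\<^sup>2 * (fps_const b - fps_const c * fps_X * g) * (g * k)"
      by (simp only: gk)
    also have "\<dots> = (g - fps_X\<^sup>2 * (fps_const b - fps_const c * fps_X * g) * g) * k"
      by (simp add: algebra_simps)
    \<comment> \<open>This is the quadratic equation of \<open>g\<close> rearranged: the
      \<open>a\<close> term moves to the right and the \<open>c\<close> term to the left, while the
      two \<open>b\<close> terms change sides.\<close>
    also have "g - fps_X\<^sup>2 * (fps_const b - fps_const c * fps_X * g) * g = fps_compose p y"
      using g unfolding py unfolding y_def p_def q_def by (simp add: power2_eq_square algebra_simps)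
    finally show ?thesis ..
  qed
  ultimately have "h = k"
    by (rule fps_quadratic_unique) (simp_all add: py qy y0 power2_eq_square)
  then have "involutory g"
    using g0 gk by (intro involutoryI) (simp_all add: h_def y_def)
  then show ?thesis
    by (simp add: g_def p_def q_def)
qed

end
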